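(* Let $D\subseteq\mathbb{R}$ be an open interval, let $f:D\to\mathbb{R}$ be a sufficiently differentiable function, and let $\alpha\in D$ be a simple root of $f(x)=0$. Let $\kappa\neq0$, $g_1,g_2$ and $a_1,\dots,a_8$ be real numbers, and consider the iterative scheme $$w_n=x_n-\kappa f(x_n),\qquad y_n=x_n-\frac{f(x_n)}{f[x_n,w_n]},$$ $$z_n=y_n-\left[\frac{1-g_1-g_2}{f[y_n,w_n]}G_0(t_1)+\frac{g_1}{f[x_n,y_n]}G_1(t_2)+\frac{g_2}{f[x_n,w_n]}G_2(t_1,t_2)\right]f(y_n),$$ $$x_{n+1}=z_n-H(t_3,t_4,t_5)\,\frac{f(z_n)}{f[z_n,y_n]+\left(f[z_n,x_n]-f[w_n,x_n]\right)\frac{z_n-y_n}{z_n-x_n}},$$ where $t_1=\frac{f(y_n)}{f(x_n)}$, $t_2=\frac{f(y_n)}{f(w_n)}$, $t_3=\frac{f(z_n)}{f(x_n)}$, $t_4=\frac{f(z_n)}{f(w_n)}$, $t_5=\frac{f(z_n)}{f(y_n)}$, and the weight functions have the expansions $$\begin{aligned}G_0(t_1)&=1+t_1+a_1t_1^2+\text{higher powers in }t_1,\\ G_1(t_2)&=1+t_2+a_2t_2^2+\text{higher powers in }t_2,\\ G_2(t_1,t_2)&=1+t_1+t_2+a_3t_1^2+a_4t_2^2+a_5t_1t_2+\text{higher powers in }t_1,t_2,\\ H(t_3,t_4,t_5)&=1+a_6t_3+a_7t_4+a_8t_5+\text{higher powers in }t_3,t_4,t_5.\end{aligned}$$ If $x_0$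 is chosen sufficiently close to $\alpha$, then the scheme has convergence order at least six if $$G_0(0)=1,\ G_1(0)=1,\ G_2(0,0)=1,\ H(0,0,0)=1,\quad \frac{dG_0}{dt_1}(0)=1,\ \frac{dG_1}{dt_2}(0)=1,\ \frac{\partial G_2}{\partial t_1}(0,0)=1,\ \frac{\partial G_2}{\partial t_2}(0,0)=1.$$
   Context: Divided difference: $f[a,b]=\frac{f(a)-f(b)}{a-b}$ for $a\neq b$. Write $e_n=x_n-\alpha$. Convergence order at least $p$ means that the error satisfies $e_{n+1}=K e_n^{p}+O(e_n^{p+1})$ as $x_n\to\alpha$, where $K$ is a constant depending on $f$, the parameters and the weight functions (possibly zero). The iteration formulas are understood at steps where all denominators are nonzero. The weight functions are smooth near the origin, with the displayed Taylor expansions there. *)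

theory Defs
  imports "HOL-Analysis.Analysis" "HOL-Library.Landau_Symbols"
begin

(* Class C^k on an open set S: all iterated directional derivatives up to
   order k exist, with total differentiability at each stage, and those of
   order k are continuous. *)
fun Ck_on :: "nat \<Rightarrow> 'a::real_normed_vector set \<Rightarrow> ('a \<Rightarrow> 'b::real_normed_vector) \<Rightarrow> bool" where
  "Ck_on 0 S f \<longleftrightarrow> continuous_on S f"
| "Ck_on (Suc k) S f \<longleftrightarrow>
     (\<forall>x\<in>S. f differentiable (at x)) \<and>
     (\<forall>v. Ck_on k S (\<lambda>x. frechet_derivative f (at x) v))"

definition smooth_near :: "'a::real_normed_vector \<Rightarrow> ('a \<Rightarrow> 'b::real_normed_vector) \<Rightarrow> bool" where
  "smooth_near p f \<longleftrightarrow> (\<exists>U. open U \<and> p \<in> U \<and> (\<forall>k. Ck_on k U f))"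

definition divdiff :: "(real \<Rightarrow> real) \<Rightarrow> real \<Rightarrow> real \<Rightarrow> real" where
  "divdiff f a b = (f a - f b) / (a - b)"

(* A relation rather than a function: x is related to x' when every denominator
   in the formulas, including those hidden in the divided differences and in
   t1, ..., t5, is nonzero and x' is the resulting next iterate.  It is not required
   that x, w, y, z lie in the domain D of f: close to the root they do. *)
definition scheme_step ::
  "(real \<Rightarrow> real) \<Rightarrow> real \<Rightarrow> real \<Rightarrow> real \<Rightarrow>
   (real \<Rightarrow> real) \<Rightarrow> (real \<Rightarrow> real) \<Rightarrow> (real \<times> real \<Rightarrow> real) \<Rightarrow> (real \<times> real \<times> real \<Rightarrow> real) \<Rightarrow>
   real \<Rightarrow> real \<Rightarrow> bool" where
  "scheme_step f \<kappa> g1 g2 G0 G1 G2 H x x' \<longleftrightarrow>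
     (let w = x - \<kappa> * f x;
          y = x - f x / divdiff f x w;
          t1 = f y / f x;
          t2 = f y / f w;
          z = y - ((1 - g1 - g2) / divdiff f y w * G0 t1
                   + g1 / divdiff f x y * G1 t2
                   + g2 / divdiff f x w * G2 (t1, t2)) * f y;
          t3 = f z / f x;
          t4 = f z / f w;
          t5 = f z / f y;
          d = divdiff f z y + (divdiff f z x - divdiff f w x) * ((z - y) / (z - x))
      in x \<noteq> w \<and> y \<noteq> w \<and> x \<noteq> y \<and> z \<noteq> y \<and> z \<noteq> x \<and>
         divdiff f x w \<noteq> 0 \<and> divdiff f y w \<noteq> 0 \<and> divdiff f x y \<noteq> 0 \<and>
         f x \<noteq> 0 \<and> f w \<noteq> 0 \<and> f y \<noteq> 0 \<and> d \<noteq> 0 \<and>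
         x' = z - H (t3, t4, t5) * (f z / d))"

(* The sequences x are runs of a one-step method S started near the root.  The
   constants K and C do not depend on the run.  The error relation
   e_{n+1} = K e_n^p + O(e_n^{p+1}) is required at step n as soon as steps
   0, ..., n can be carried out, so runs that break down later are included. *)
definition local_convergence_order_at_least ::
  "nat \<Rightarrow> (real \<Rightarrow> real \<Rightarrow> bool) \<Rightarrow> real \<Rightarrow> bool" where
  "local_convergence_order_at_least p S \<alpha> \<longleftrightarrow>
     (\<exists>K C \<delta>. \<delta> > 0 \<and>
        (\<forall>x :: nat \<Rightarrow> real. \<bar>x 0 - \<alpha>\<bar> < \<delta> \<longrightarrow>
           (\<forall>n. (\<forall>m\<le>n. S (x m) (x (Suc m))) \<longrightarrow>
                \<bar>(x (Suc n) - \<alpha>) - K * (x n - \<alpha>) ^ p\<bar> \<le> C * \<bar>x n - \<alpha>\<bar> ^ (p + 1)) \<and>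
           ((\<forall>n. S (x n) (x (Suc n))) \<longrightarrow> x \<longlonglongrightarrow> \<alpha>)))"

end

theory Submission
  imports Defs "HOL-Computational_Algebra.Polynomial"
begin

text \<open>Write \<open>f (\<alpha> + u) = u \<Phi>(u)\<close> and \<open>\<Phi>(u) - \<Phi>(v) = (u - v) \<Psi>(u, v)\<close>. Then
  \<open>f[\<alpha> + u, \<alpha> + v] = \<Phi>(u) + v \<Psi>(u, v)\<close>, where \<open>\<Psi>(u, v) = c2 + c3 (u + v) + O(u\<^sup>2 + v\<^sup>2)\<close> uniformly, and
  the error formulas factor exactly. With \<open>h = e\<^sub>n\<close>, the error of \<open>w\<close> is \<open>h (1 - \<kappa> \<Phi>(h))\<close>, the error of
  \<open>y\<close> is that of \<open>w\<close> times \<open>b = h \<Psi>(h, e\<^sub>w) / f[x, w]\<close>, the error of \<open>z\<close> is that of \<open>y\<close> times some \<open>s\<close>, and the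
  error of the next iterate is that of \<open>z\<close> times some \<open>r\<close>. The conditions on the weight functions
  make the coefficients of \<open>1\<close> and \<open>h\<close> vanish in both \<open>s\<close> and \<open>r\<close>, so the product of
  the four factors is \<open>K h\<^sup>6 + O(h\<^sup>7)\<close>.\<close>

section \<open>Polynomial expansions at 0 with remainder \<open>O(h ^ n)\<close>\<close>

text \<open>The degree of \<open>p\<close> is not bounded: terms from degree \<open>n\<close> on are
  absorbed by the remainder, so expansions multiply without truncation.\<close>

definition expands :: "nat \<Rightarrow> (real \<Rightarrow> real) \<Rightarrow> real poly \<Rightarrow> bool" where
  "expands n u p \<longleftrightarrow> (\<lambda>h. u h - poly p h) \<in> O[at 0](\<lambda>h. h ^ n)"

lemma monom_1_2_dvd_iff:
  fixes p :: "'a::comm_semiring_1 poly"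
  shows "monom 1 2 dvd p \<longleftrightarrow> coeff p 0 = 0 \<and> coeff p (Suc 0) = 0"
  by (auto simp: monom_1_dvd_iff' less_2_cases_iff)

lemma bigo_tendsto_zero:
  fixes u v :: "'a \<Rightarrow> real"
  assumes "u \<in> O[F](v)" "(v \<longlongrightarrow> 0) F"
  shows "(u \<longlongrightarrow> 0) F"
proof -
  from assms(1) obtain c where "eventually (\<lambda>h. norm (u h) \<le> c * norm (v h)) F"
    by (elim landau_o.bigE)
  moreover have "((\<lambda>h. c * norm (v h)) \<longlongrightarrow> 0) F"
    using assms(2) by (auto intro!: tendsto_eq_intros)
  ultimately show ?thesis by (rule Lim_null_comparison)
qed

text \<open>Divisibility by \<open>monom 1 n\<close> is the algebraic form of vanishing to order
  \<open>n\<close> at 0; the cofactor is bounded near 0 by continuity.\<close>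

lemma poly_bigo_power:
  fixes p :: "real poly"
  assumes "monom 1 n dvd p"
  shows "poly p \<in> O[at 0](\<lambda>h. h ^ n)"
proof -
  from assms obtain q where q: "p = monom 1 n * q" by (elim dvdE)
  have "((\<lambda>h. poly q h) \<longlongrightarrow> poly q 0) (at 0)"
    by (intro tendsto_intros)
  then have "poly q \<in> O[at 0](\<lambda>_. 1)"
    by (intro bigoI_tendsto[where c = "poly q 0"]) auto
  then have "(\<lambda>h. h ^ n * poly q h) \<in> O[at 0](\<lambda>h. h ^ n * 1)"
    by (intro landau_o.big.mult landau_o.big_refl)
  moreover have "poly p = (\<lambda>h. h ^ n * poly q h)" by (simp add: q poly_monom fun_eq_iff)
  ultimately show ?thesis by simp
qed

lemma power_bigo_power:
  assumes "m \<le> n"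
  shows "(\<lambda>h::real. h ^ n) \<in> O[at 0](\<lambda>h. h ^ m)"
proof -
  have "poly (monom 1 n) = (\<lambda>h::real. h ^ n)" by (simp add: poly_monom fun_eq_iff)
  moreover have "monom (1::real) m dvd monom 1 n" using assms by (simp add: monom_1_dvd_iff')
  ultimately show ?thesis using poly_bigo_power[of m "monom 1 n"] by simp
qed

lemma expands_poly: "expands n (poly p) p"
  by (simp add: expands_def)

lemma expands_const: "expands n (\<lambda>h. c) [:c:]"
  by (simp add: expands_def)

lemma expands_id: "expands n (\<lambda>h. h) [:0, 1:]"
  by (simp add: expands_def)

lemma expands_add:
  assumes "expands n u p" "expands n v q"
  shows "expands n (\<lambda>h. u h + v h) (p + q)"
  using sum_in_bigo(1)[OF assms[unfolded expands_def]] by (simp add: expands_def algebra_simps)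

lemma expands_diff:
  assumes "expands n u p" "expands n v q"
  shows "expands n (\<lambda>h. u h - v h) (p - q)"
  using sum_in_bigo(2)[OF assms[unfolded expands_def]] by (simp add: expands_def algebra_simps)

lemma expands_bigo:
  assumes "expands n u p" "(\<lambda>h. v h - u h) \<in> O[at 0](\<lambda>h. h ^ n)"
  shows "expands n v p"
  using sum_in_bigo(1)[OF assms[unfolded expands_def]] by (simp add: expands_def)

lemma expands_mono:
  assumes "expands n u p" "m \<le> n"
  shows "expands m u p"
  using assms(1) power_bigo_power[OF assms(2)] unfolding expands_def
  by (rule landau_o.big_trans)

lemma expands_bigo_power:
  assumes "expands n u p" "monom 1 m dvd p" "m \<le> n"
  shows "u \<in> O[at 0](\<lambda>h. h ^ m)"
proof -
  have "(\<lambda>h. u h - poly p h) \<in> O[at 0](\<lambda>h. h ^ m)"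
    using expands_mono[OF assms(1,3)] by (simp add: expands_def)
  from sum_in_bigo(1)[OF this poly_bigo_power[OF assms(2)]] show ?thesis by simp
qed

text \<open>The error of the product is \<open>(u - p) v + p (v - q)\<close>. The order of vanishing
  of each factor adds to the precision of the other, so \<open>n\<close> orders from degree
  \<open>m + k\<close> on survive.\<close>

lemma expands_mult_dvd:
  assumes u: "expands (m + n) u p" "monom 1 m dvd p" and v: "expands (k + n) v q" "monom 1 k dvd q"
  shows "expands (m + k + n) (\<lambda>h. u h * v h) (p * q)"
proof -
  have "(\<lambda>h. (u h - poly p h) * v h) \<in> O[at 0](\<lambda>h. h ^ (m + n) * h ^ k)"
    using u expands_bigo_power[OF v] unfolding expands_def by (intro landau_o.big.mult) auto
  moreover have "(\<lambda>h. poly p h * (v h - poly q h)) \<in> O[at 0](\<lambda>h. h ^ m * h ^ (k + n))"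
    using v poly_bigo_power[OF u(2)] unfolding expands_def by (intro landau_o.big.mult) auto
  ultimately have "(\<lambda>h. (u h - poly p h) * v h + poly p h * (v h - poly q h)) \<in> O[at 0](\<lambda>h. h ^ (m + k + n))"
    by (intro sum_in_bigo) (simp_all add: power_add mult_ac)
  then show ?thesis by (simp add: expands_def algebra_simps)
qed

lemma expands_mult:
  assumes "expands n u p" "expands n v q"
  shows "expands n (\<lambda>h. u h * v h) (p * q)"
  using expands_mult_dvd[of 0 n u p 0 v q] assms by (simp add: monom_1_dvd_iff')

lemma expands_tendsto:
  assumes u: "expands n u p" and "n > 0"
  shows "(u \<longlongrightarrow> coeff p 0) (at 0)"
proof -
  have "((\<lambda>h::real. h ^ n) \<longlongrightarrow> 0 ^ n) (at 0)"
    by (intro tendsto_intros)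
  then have "((\<lambda>h::real. h ^ n) \<longlongrightarrow> 0) (at 0)" using \<open>n > 0\<close> by (simp add: zero_power)
  with u have "((\<lambda>h. u h - poly p h) \<longlongrightarrow> 0) (at 0)"
    unfolding expands_def by (rule bigo_tendsto_zero)
  moreover have "((\<lambda>h. poly p h) \<longlongrightarrow> poly p 0) (at 0)"
    by (intro tendsto_intros)
  ultimately have "((\<lambda>h. (u h - poly p h) + poly p h) \<longlongrightarrow> 0 + poly p 0) (at 0)"
    by (rule tendsto_add)
  then show ?thesis by (simp add: poly_0_coeff_0)
qed

text \<open>With \<open>a = coeff p 0\<close> and \<open>s = 1 - p / a\<close>, the truncated geometric series of \<open>s\<close>, divided
  by \<open>a\<close>, is an inverse of \<open>p\<close> up to the error \<open>s ^ n\<close>, which is divisible by the \<open>n\<close>-th power of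
  the variable.\<close>

lemma expands_inverse:
  assumes u: "expands n u p" and "n > 0" and p0: "coeff p 0 \<noteq> 0"
  obtains q where "expands n (\<lambda>h. inverse (u h)) q" "monom 1 n dvd p * q - 1"
proof -
  define a where "a = coeff p 0"
  define s where "s = 1 - smult (inverse a) p"
  define q where "q = smult (inverse a) (\<Sum>k<n. s ^ k)"
  have a: "a \<noteq> 0" using p0 by (simp add: a_def)
  have s0: "coeff s 0 = 0" using a by (simp add: s_def a_def)
  then obtain s' where s': "s = pCons 0 s'" by (cases s) auto
  have "p * q = (1 - s) * (\<Sum>k<n. s ^ k)" using a by (simp add: q_def s_def)
  also have "\<dots> = 1 - s ^ n" by (simp add: one_diff_power_eq)
  finally have pq: "p * q = 1 - s ^ n" .
  have "s = monom 1 1 * s'" by (simp add: s' monom_altdef)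
  then have sn_dvd: "monom 1 n dvd s ^ n" by (simp add: power_mult_distrib monom_power)
  then have sn: "poly (s ^ n) \<in> O[at 0](\<lambda>h. h ^ n)" by (rule poly_bigo_power)
  have "(\<lambda>h. u h * poly q h - poly (p * q) h) \<in> O[at 0](\<lambda>h. h ^ n)"
    using expands_mult[OF u expands_poly[of n q]] by (simp add: expands_def)
  from sum_in_bigo(2)[OF sn this] have num: "(\<lambda>h. 1 - u h * poly q h) \<in> O[at 0](\<lambda>h. h ^ n)"
    unfolding pq by simp
  have lim: "(u \<longlongrightarrow> a) (at 0)" unfolding a_def by (rule expands_tendsto[OF u \<open>n > 0\<close>])
  have "(\<lambda>h. inverse (u h)) \<in> O[at 0](\<lambda>_. 1)"
    by (rule bigoI_tendsto[where c = "inverse a"]) (use a in \<open>auto intro!: tendsto_eq_intros lim\<close>)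
  from landau_o.big.mult[OF num this]
  have "(\<lambda>h. (1 - u h * poly q h) * inverse (u h)) \<in> O[at 0](\<lambda>h. h ^ n)" by simp
  moreover have "eventually (\<lambda>h. (1 - u h * poly q h) * inverse (u h) = inverse (u h) - poly q h) (at 0)"
    using tendsto_imp_eventually_ne[OF lim a] by eventually_elim (simp add: field_simps)
  ultimately have "expands n (\<lambda>h. inverse (u h)) q"
    unfolding expands_def using landau_o.big.in_cong by fastforce
  moreover have "monom 1 n dvd p * q - 1" using sn_dvd by (simp add: pq)
  ultimately show thesis by (rule that)
qed

text \<open>Produces the asymptotic constant \<open>K\<close> as a coefficient: divisibility
  excludes the terms below degree \<open>n\<close>, and those above it go into the
  remainder.\<close>

lemma expands_leading_term:
  assumes "expands (Suc n) u p" "monom 1 n dvd p"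
  shows "(\<lambda>h. u h - coeff p n * h ^ n) \<in> O[at 0](\<lambda>h. h ^ Suc n)"
proof -
  have "monom 1 (Suc n) dvd p - monom (coeff p n) n"
    using assms(2) by (auto simp: monom_1_dvd_iff' less_Suc_eq)
  then have "poly (p - monom (coeff p n) n) \<in> O[at 0](\<lambda>h. h ^ Suc n)"
    by (rule poly_bigo_power)
  from sum_in_bigo(1)[OF assms(1)[unfolded expands_def] this] show ?thesis
    by (simp add: poly_monom)
qed


section \<open>Calculus of the two lowest coefficients\<close>

text \<open>Only the two lowest coefficients of an expansion ever need to be known; the remaining ones
  merely have to exist.\<close>

definition jet :: "nat \<Rightarrow> (real \<Rightarrow> real) \<Rightarrow> real \<Rightarrow> real \<Rightarrow> bool" where
  "jet n u a b \<longleftrightarrow> (\<exists>p. expands n u p \<and> coeff p 0 = a \<and> coeff p (Suc 0) = b)"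

lemma coeff_mult_1:
  fixes p q :: "'a::comm_semiring_0 poly"
  shows "coeff (p * q) (Suc 0) = coeff p 0 * coeff q (Suc 0) + coeff p (Suc 0) * coeff q 0"
  by (simp add: coeff_mult)

lemma jetI: "expands n u p \<Longrightarrow> coeff p 0 = a \<Longrightarrow> coeff p (Suc 0) = b \<Longrightarrow> jet n u a b"
  by (auto simp: jet_def)

lemma jetE:
  assumes "jet n u a b"
  obtains p where "expands n u p" "coeff p 0 = a" "coeff p (Suc 0) = b"
  using assms by (auto simp: jet_def)

lemma jet_const: "jet n (\<lambda>h. c) c 0"
  by (rule jetI[OF expands_const]) auto

lemma jet_id: "jet n (\<lambda>h. h) 0 1"
  by (rule jetI[OF expands_id]) auto

lemma jet_add: "jet n u a b \<Longrightarrow> jet n v a' b' \<Longrightarrow> jet n (\<lambda>h. u h + v h) (a + a') (b + b')"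
  by (elim jetE, rule jetI[OF expands_add]) auto

lemma jet_diff: "jet n u a b \<Longrightarrow> jet n v a' b' \<Longrightarrow> jet n (\<lambda>h. u h - v h) (a - a') (b - b')"
  by (elim jetE, rule jetI[OF expands_diff]) auto

lemma jet_mult: "jet n u a b \<Longrightarrow> jet n v a' b' \<Longrightarrow> jet n (\<lambda>h. u h * v h) (a * a') (a * b' + b * a')"
  by (elim jetE, rule jetI[OF expands_mult]) (auto simp: coeff_mult_0 coeff_mult_1)

text \<open>The zero of \<open>u\<close> at 0 gains one order, so precision \<open>n\<close> of
  \<open>v\<close> is enough. This serves products with \<open>\<Psi>\<close> and its quotients,
  which are known only to precision 2.\<close>

lemma jet_mult_Suc:
  assumes "jet (Suc n) u 0 b" "jet n v a' b'"
  shows "jet (Suc n) (\<lambda>h. u h * v h) 0 (b * a')"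
proof -
  from assms(1) obtain p where p: "expands (Suc n) u p" "coeff p 0 = 0" "coeff p (Suc 0) = b"
    by (rule jetE)
  from assms(2) obtain q where q: "expands n v q" "coeff q 0 = a'"
    by (rule jetE)
  have "expands (Suc n) (\<lambda>h. u h * v h) (p * q)"
    using expands_mult_dvd[of 1 n u p 0 v q] p q by (simp add: monom_1_dvd_iff')
  then show ?thesis by (rule jetI) (use p q in \<open>auto simp: coeff_mult_0 coeff_mult_1\<close>)
qed

lemma jet_mono: "jet n u a b \<Longrightarrow> m \<le> n \<Longrightarrow> jet m u a b"
  unfolding jet_def using expands_mono by blast

lemma jet_bigo:
  "jet n u a b \<Longrightarrow> (\<lambda>h. v h - u h) \<in> O[at 0](\<lambda>h. h ^ n) \<Longrightarrow> jet n v a b"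
  unfolding jet_def using expands_bigo by blast

lemma jet_tendsto: "jet n u a b \<Longrightarrow> n > 0 \<Longrightarrow> (u \<longlongrightarrow> a) (at 0)"
  unfolding jet_def using expands_tendsto by blast

text \<open>The coefficients of the reciprocal come from comparing degrees 0 and 1 in
  \<open>p * q = 1\<close> modulo \<open>h ^ n\<close>; both degrees are visible because
  \<open>n > 1\<close>.\<close>

lemma jet_divide:
  assumes u: "jet n u a b" and v: "jet n v a' b'" and n: "n > 1" and a': "a' \<noteq> 0"
  shows "jet n (\<lambda>h. u h / v h) (a / a') ((b - a * b' / a') / a')"
proof -
  from v obtain p where p: "expands n v p" "coeff p 0 = a'" "coeff p (Suc 0) = b'"
    by (rule jetE)
  from expands_inverse[OF p(1)] n a' p(2) obtain q where
    q: "expands n (\<lambda>h. inverse (v h)) q" "monom 1 n dvd p * q - 1" by auto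
  from q(2) n have "coeff (p * q - 1) 0 = 0" "coeff (p * q - 1) (Suc 0) = 0"
    by (simp_all add: monom_1_dvd_iff')
  then have "a' * coeff q 0 = 1" "a' * coeff q (Suc 0) + b' * coeff q 0 = 0"
    by (simp_all add: coeff_mult_0 coeff_mult_1 p)
  then have q0: "coeff q 0 = 1 / a'" and "coeff q (Suc 0) = - b' * coeff q 0 / a'"
    using a' by (simp_all add: field_simps eq_neg_iff_add_eq_0)
  then have "jet n (\<lambda>h. inverse (v h)) (1 / a') (- b' / a' / a')"
    by (intro jetI[OF q(1)]) auto
  from jet_mult[OF u this] show ?thesis using a' by (simp add: field_simps)
qed

lemma jet_bigo_id: "jet n u 0 b \<Longrightarrow> n > 0 \<Longrightarrow> u \<in> O[at 0](\<lambda>h. h ^ 1)"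
  by (elim jetE, rule expands_bigo_power) (auto simp: monom_1_dvd_iff')

lemma jet_bigo_square: "jet n u 0 0 \<Longrightarrow> n > 1 \<Longrightarrow> u \<in> O[at 0](\<lambda>h. h ^ 2)"
  by (elim jetE, rule expands_bigo_power) (auto simp: monom_1_2_dvd_iff simp del: One_nat_def)

section \<open>Taylor bounds and the factorization of \<open>f\<close> at the root\<close>

text \<open>On the real line the direction 1 determines the Frechet derivative, so following it at
  every stage yields a chain of ordinary derivatives in the shape that \<open>Taylor\<close>
  expects.\<close>

lemma Ck_on_real_derivatives:
  fixes f :: "real \<Rightarrow> real"
  assumes "Ck_on n S f"
  obtains diff :: "nat \<Rightarrow> real \<Rightarrow> real" where "diff 0 = f"
    "\<And>m x. m < n \<Longrightarrow> x \<in> S \<Longrightarrow> (diff m has_real_derivative diff (Suc m) x) (at x)"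
    "continuous_on S (diff n)"
proof -
  have "\<exists>diff. diff 0 = f \<and> 
      (\<forall>m x. m < n \<longrightarrow> x \<in> S \<longrightarrow> (diff m has_real_derivative diff (Suc m) x) (at x)) \<and>
      continuous_on S (diff n)"
    using assms
  proof (induction n arbitrary: f)
    case 0
    then show ?case by (intro exI[of _ "\<lambda>_. f"]) auto
  next
    case (Suc n)
    define g where "g = (\<lambda>x. frechet_derivative f (at x) 1)"
    have "Ck_on n S g" using Suc.prems by (simp add: g_def)
    from Suc.IH[OF this] obtain diff where diff: "diff 0 = g" 
      "\<And>m x. m < n \<Longrightarrow> x \<in> S \<Longrightarrow> (diff m has_real_derivative diff (Suc m) x) (at x)"
      "continuous_on S (diff n)" by blast
    have g: "(f has_real_derivative g x) (at x)" if "x \<in> S" for x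
    proof -
      have D: "(f has_derivative frechet_derivative f (at x)) (at x)"
        using Suc.prems that by (simp add: frechet_derivative_works)
      interpret linear "frechet_derivative f (at x)" by (rule has_derivative_linear[OF D])
      have "frechet_derivative f (at x) t = g x * t" for t
        using scale[of t 1] unfolding g_def real_scaleR_def mult_1_right mult.commute[of _ t] .
      then have "frechet_derivative f (at x) = (*) (g x)" by (rule ext)
      with D show ?thesis by (simp add: has_field_derivative_def)
    qed
    show ?case
    proof (intro exI[of _ "\<lambda>m. case m of 0 \<Rightarrow> f | Suc k \<Rightarrow> diff k"] conjI allI impI)
      fix m x assume "m < Suc n" "x \<in> S"
      then show "((case m of 0 \<Rightarrow> f | Suc k \<Rightarrow> diff k) has_real_derivative
          (case Suc m of 0 \<Rightarrow> f | Suc k \<Rightarrow> diff k) x) (at x)"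
        using g diff by (cases m) auto
    qed (use diff in auto)
  qed
  then show thesis using that by blast
qed

text \<open>Lagrange form of the remainder, with \<open>1 / fact n\<close> estimated by 1. The case
  \<open>u = 0\<close> is separate because \<open>Taylor\<close> asks for two distinct
  points.\<close>

lemma Taylor_remainder_bound:
  fixes diff :: "nat \<Rightarrow> real \<Rightarrow> real"
  assumes "n > 0" and \<delta>: "\<delta> > 0"
    and deriv: "\<And>m x. m < n \<Longrightarrow> \<bar>x - a\<bar> < \<delta> \<Longrightarrow> (diff m has_real_derivative diff (Suc m) x) (at x)"
    and B: "\<And>x. \<bar>x - a\<bar> < \<delta> \<Longrightarrow> \<bar>diff n x\<bar> \<le> B"
    and u: "\<bar>u\<bar> < \<delta>"
  shows "\<bar>diff 0 (a + u) - (\<Sum>m<n. diff m a / fact m * u ^ m)\<bar> \<le> B * \<bar>u\<bar> ^ n"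
proof (cases "u = 0")
  case True
  obtain k where "n = Suc k" using \<open>n > 0\<close> by (cases n) auto
  then show ?thesis using True by (simp add: sum.lessThan_Suc_shift)
next
  case False
  have "\<exists>t. (if a + u < a then a + u < t \<and> t < a else a < t \<and> t < a + u) \<and>
    diff 0 (a + u) = (\<Sum>m<n. (diff m a / fact m) * (a + u - a)^m) + (diff n t / fact n) * (a + u - a)^n"
    by (rule Taylor[where a = "min a (a + u)" and b = "max a (a + u)"])
       (use assms False in \<open>auto simp: abs_if split: if_splits\<close>)
  then obtain t where t: "if a + u < a then a + u < t \<and> t < a else a < t \<and> t < a + u"
    and eq: "diff 0 (a + u) = (\<Sum>m<n. (diff m a / fact m) * u^m) + (diff n t / fact n) * u^n" by auto
  have "\<bar>t - a\<bar> < \<delta>" using t u by (auto split: if_splits)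
  then have Bt: "\<bar>diff n t\<bar> \<le> B" by (rule B)
  have "\<bar>diff n t\<bar> / fact n \<le> \<bar>diff n t\<bar> / 1"
    by (intro divide_left_mono) (auto simp: fact_ge_1)
  with Bt have "\<bar>diff n t / fact n\<bar> \<le> B" by simp
  then have "\<bar>diff n t / fact n\<bar> * \<bar>u\<bar> ^ n \<le> B * \<bar>u\<bar> ^ n" by (intro mult_right_mono) auto
  then show ?thesis using eq by (simp add: abs_mult power_abs)
qed

text \<open>In the proof, \<open>R(u)\<close> is the remainder of the cubic Taylor polynomial of \<open>f\<close> at \<open>\<alpha>\<close>, divided by \<open>u\<close>.
  A bound on its derivative yields bounds on difference quotients that are uniform in how close the
  two points are to each other.\<close>

lemma simple_root_factorization:
  fixes f :: "real \<Rightarrow> real"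
  assumes "open D" "\<alpha> \<in> D" "Ck_on 4 D f" "f \<alpha> = 0"
  obtains \<Phi> \<Psi> :: "real \<Rightarrow> _" and c2 c3 C \<delta> :: real where "\<delta> > 0"
    "\<And>u. f (\<alpha> + u) = u * \<Phi> u" "\<Phi> 0 = deriv f \<alpha>"
    "\<And>u v. \<Phi> u - \<Phi> v = (u - v) * \<Psi> u v"
    "\<And>u v \<rho>. \<bar>u\<bar> \<le> \<rho> \<Longrightarrow> \<bar>v\<bar> \<le> \<rho> \<Longrightarrow> \<rho> < \<delta> \<Longrightarrow> \<bar>\<Psi> u v - (c2 + c3 * (u + v))\<bar> \<le> C * \<rho>\<^sup>2"
proof -
  from Ck_on_real_derivatives[OF assms(3)] obtain diff where diff0: "diff 0 = f"
    and diff: "\<And>m x. m < 4 \<Longrightarrow> x \<in> D \<Longrightarrow> (diff m has_real_derivative diff (Suc m) x) (at x)"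
    and cont: "continuous_on D (diff 4)" by blast
  from assms(1,2) obtain r where r: "r > 0" "cball \<alpha> r \<subseteq> D" by (meson open_contains_cball)
  have "compact (diff 4 ` cball \<alpha> r)"
    by (intro compact_continuous_image continuous_on_subset[OF cont] r compact_cball)
  then have "bounded (diff 4 ` cball \<alpha> r)" by (rule compact_imp_bounded)
  then obtain B where "\<forall>y\<in>diff 4 ` cball \<alpha> r. norm y \<le> B" by (auto simp: bounded_iff)
  then have B: "\<bar>diff 4 x\<bar> \<le> B" if "x \<in> cball \<alpha> r" for x using that by force
  have inD: "x \<in> D" if "\<bar>x - \<alpha>\<bar> < r" for x
    using that r(2) by (auto simp: dist_real_def abs_minus_commute subset_iff)
  have B': "\<bar>diff 4 x\<bar> \<le> B" if "\<bar>x - \<alpha>\<bar> < r" for x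
    using that by (intro B) (auto simp: dist_real_def abs_minus_commute)
  define c1 c2 c3 where "c1 = diff 1 \<alpha>" and "c2 = diff 2 \<alpha> / 2" and "c3 = diff 3 \<alpha> / 6"
  have T0: "\<bar>f (\<alpha> + u) - (c1 * u + c2 * u\<^sup>2 + c3 * u ^ 3)\<bar> \<le> B * \<bar>u\<bar> ^ 4" if "\<bar>u\<bar> < r" for u
    using Taylor_remainder_bound[of 4 r \<alpha> diff B u] r(1) diff inD B' that
    by (simp add: diff0 assms(4) c1_def c2_def c3_def eval_nat_numeral algebra_simps)
  \<comment> \<open>The chain shifted by one expands the derivative of \<open>f\<close>; the same
    fourth derivative bounds its remainder.\<close>
  have T1: "\<bar>diff 1 (\<alpha> + u) - (c1 + 2 * c2 * u + 3 * c3 * u\<^sup>2)\<bar> \<le> B * \<bar>u\<bar> ^ 3" if "\<bar>u\<bar> < r" for u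
    using Taylor_remainder_bound[of 3 r \<alpha> "\<lambda>m. diff (Suc m)" B u] r(1) diff inD B' that
    by (simp add: c1_def c2_def c3_def eval_nat_numeral algebra_simps)
  define \<Phi> where "\<Phi> = (\<lambda>u. if u = 0 then c1 else f (\<alpha> + u) / u)"
  define R where "R = (\<lambda>u. \<Phi> u - (c1 + c2 * u + c3 * u\<^sup>2))"
  \<comment> \<open>Away from 0 this is the quotient rule; at 0 it is the limit of
    \<open>R h / h\<close>, which the cubic bound on \<open>R\<close> forces to be 0.\<close>
  define R' where "R' = (\<lambda>u. if u = 0 then 0 else
     (diff 1 (\<alpha> + u) * u - f (\<alpha> + u)) / u\<^sup>2 - (c2 + 2 * c3 * u))"
  have R_le: "\<bar>R u\<bar> \<le> B * \<bar>u\<bar> ^ 3" if "\<bar>u\<bar> < r" for u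
  proof (cases "u = 0")
    case False
    have "u * R u = f (\<alpha> + u) - (c1 * u + c2 * u\<^sup>2 + c3 * u ^ 3)"
      using False by (simp add: R_def \<Phi>_def field_simps power2_eq_square power3_eq_cube)
    with T0[OF that] have "\<bar>u\<bar> * \<bar>R u\<bar> \<le> \<bar>u\<bar> * (B * \<bar>u\<bar> ^ 3)"
      by (simp add: eval_nat_numeral algebra_simps flip: abs_mult)
    then show ?thesis using False by simp
  qed (simp add: R_def \<Phi>_def)
  have R'_le: "\<bar>R' u\<bar> \<le> 2 * B * u\<^sup>2" if "\<bar>u\<bar> < r" for u
  proof (cases "u = 0")
    case False
    \<comment> \<open>Two Taylor remainders enter, hence the factor 2 in the bound.\<close>
    have "u * R' u = (diff 1 (\<alpha> + u) - (c1 + 2 * c2 * u + 3 * c3 * u\<^sup>2)) - R u"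
      using False by (simp add: R_def R'_def \<Phi>_def field_simps power2_eq_square power3_eq_cube)
    with T1[OF that] R_le[OF that] have "\<bar>u * R' u\<bar> \<le> 2 * (B * \<bar>u\<bar> ^ 3)" by linarith
    also have "\<dots> = \<bar>u\<bar> * (2 * B * u\<^sup>2)" by (simp add: eval_nat_numeral)
    finally have "\<bar>u\<bar> * \<bar>R' u\<bar> \<le> \<bar>u\<bar> * (2 * B * u\<^sup>2)" by (simp add: abs_mult)
    then show ?thesis using False by simp
  qed (simp add: R'_def)
  have R_deriv: "(R has_real_derivative R' u) (at u)" if "\<bar>u\<bar> < r" for u
  proof (cases "u = 0")
    case True
    have "((\<lambda>h. B * \<bar>h\<bar>\<^sup>2) \<longlongrightarrow> 0) (at 0)" by (auto intro!: tendsto_eq_intros)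
    moreover have "eventually (\<lambda>h. norm (R h / h) \<le> B * \<bar>h\<bar>\<^sup>2) (at 0)"
      unfolding eventually_at
    proof (intro exI[of _ r] conjI ballI impI r)
      fix h :: real assume "h \<noteq> 0 \<and> dist h 0 < r"
      with R_le[of h] show "norm (R h / h) \<le> B * \<bar>h\<bar>\<^sup>2"
        by (simp add: field_simps eval_nat_numeral)
    qed
    ultimately have "((\<lambda>h. R h / h) \<longlongrightarrow> 0) (at 0)" by (rule Lim_null_comparison[rotated])
    moreover have "R 0 = 0" by (simp add: R_def \<Phi>_def)
    ultimately show ?thesis unfolding DERIV_def R'_def True by simp
  next
    case False
    have "(f has_real_derivative diff 1 (\<alpha> + u)) (at (\<alpha> + u))"
      using diff[of 0 "\<alpha> + u"] inD[of "\<alpha> + u"] that by (simp add: diff0)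
    then have D: "((\<lambda>u. f (\<alpha> + u)) has_real_derivative diff 1 (\<alpha> + u)) (at u)"
      using DERIV_shift[of f _ u \<alpha>] by (simp add: add.commute)
    have "((\<lambda>u. f (\<alpha> + u) / u - (c1 + c2 * u + c3 * u\<^sup>2)) has_real_derivative R' u) (at u)"
      using False by (auto intro!: derivative_eq_intros D simp: R'_def power2_eq_square)
    then show ?thesis
      by (rule has_field_derivative_transform_within_open[of _ _ _ "- {0}"])
         (use False in \<open>auto simp: R_def \<Phi>_def\<close>)
  qed
  \<comment> \<open>On the diagonal any value satisfies the factorization; the linear main part
    itself makes the error there zero.\<close>
  define \<Psi> where "\<Psi> = (\<lambda>u v. if u = v then c2 + c3 * (u + v) else (\<Phi> u - \<Phi> v) / (u - v))"
  show thesis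
  proof (rule that[of r \<Phi> \<Psi> c2 c3 "2 * B"])
    show "f (\<alpha> + u) = u * \<Phi> u" for u by (simp add: \<Phi>_def assms(4))
    show "\<Phi> 0 = deriv f \<alpha>" using diff[of 0 \<alpha>] assms(2)
      by (simp add: \<Phi>_def c1_def diff0 DERIV_imp_deriv)
    show "\<Phi> u - \<Phi> v = (u - v) * \<Psi> u v" for u v by (simp add: \<Psi>_def)
    fix u v \<rho> :: real assume uv: "\<bar>u\<bar> \<le> \<rho>" "\<bar>v\<bar> \<le> \<rho>" "\<rho> < r"
    have "B \<ge> 0" using B'[of \<alpha>] r(1) by simp
    have "norm (R u - R v) \<le> 2 * B * \<rho>\<^sup>2 * norm (u - v)"
    proof (rule field_differentiable_bound[of "cball 0 \<rho>" R R'])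
      fix x assume "x \<in> cball (0::real) \<rho>"
      then have x: "\<bar>x\<bar> \<le> \<rho>" by simp
      show "(R has_field_derivative R' x) (at x within cball 0 \<rho>)"
        using R_deriv[of x] x uv(3) by (simp add: has_field_derivative_at_within)
      have "\<bar>R' x\<bar> \<le> 2 * B * x\<^sup>2" using R'_le[of x] x uv(3) by simp
      also have "\<dots> \<le> 2 * B * \<rho>\<^sup>2"
        using x \<open>B \<ge> 0\<close> by (intro mult_left_mono) (auto simp: abs_le_square_iff[symmetric])
      finally show "norm (R' x) \<le> 2 * B * \<rho>\<^sup>2" by simp
    qed (use uv in auto)
    then have R_diff: "\<bar>R u - R v\<bar> \<le> 2 * B * \<rho>\<^sup>2 * \<bar>u - v\<bar>" by simp
    show "\<bar>\<Psi> u v - (c2 + c3 * (u + v))\<bar> \<le> 2 * B * \<rho>\<^sup>2"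
    proof (cases "u = v")
      case False
      \<comment> \<open>The difference quotient of \<open>c1 + c2 * u + c3 * u\<^sup>2\<close> is
        exactly \<open>c2 + c3 * (u + v)\<close>, so only that of \<open>R\<close> is left.\<close>
      have "(u - v) * (\<Psi> u v - (c2 + c3 * (u + v))) = R u - R v"
        using False by (simp add: \<Psi>_def R_def field_simps power2_eq_square)
      with R_diff have "\<bar>u - v\<bar> * \<bar>\<Psi> u v - (c2 + c3 * (u + v))\<bar> \<le> \<bar>u - v\<bar> * (2 * B * \<rho>\<^sup>2)"
        by (simp add: mult.commute flip: abs_mult)
      then show ?thesis using False by simp
    qed (simp add: \<Psi>_def \<open>B \<ge> 0\<close>)
  qed (use r in auto)
qed

section \<open>Substitution of small functions into local estimates\<close>

text \<open>The choice \<open>\<rho> = \<bar>u h\<bar> + \<bar>v h\<bar>\<close> dominates both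
  arguments and is \<open>O(h)\<close>, so the error of the linear approximation is
  \<open>O(h ^ 2)\<close> even where \<open>u\<close> and \<open>v\<close> nearly coincide.\<close>

lemma jet_second_difference:
  fixes \<Psi> :: "real \<Rightarrow> real \<Rightarrow> real"
  assumes "\<delta> > 0"
    and \<Psi>: "\<And>u v \<rho>. \<bar>u\<bar> \<le> \<rho> \<Longrightarrow> \<bar>v\<bar> \<le> \<rho> \<Longrightarrow> \<rho> < \<delta> \<Longrightarrow> \<bar>\<Psi> u v - (c2 + c3 * (u + v))\<bar> \<le> C * \<rho>\<^sup>2"
    and u: "jet 2 u 0 a" and v: "jet 2 v 0 b"
  shows "jet 2 (\<lambda>h. \<Psi> (u h) (v h)) c2 (c3 * (a + b))"
proof -
  have main: "jet 2 (\<lambda>h. c2 + c3 * (u h + v h)) c2 (c3 * (a + b))"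
    using jet_add[OF jet_const[of 2 c2] jet_mult[OF jet_const[of 2 c3] jet_add[OF u v]]] by simp
  have uO: "u \<in> O[at 0](\<lambda>h. h)" and vO: "v \<in> O[at 0](\<lambda>h. h)"
    using jet_bigo_id[OF u] jet_bigo_id[OF v] by simp_all
  have "(\<lambda>h. \<Psi> (u h) (v h) - (c2 + c3 * (u h + v h))) \<in> O[at 0](\<lambda>h. (\<bar>u h\<bar> + \<bar>v h\<bar>)\<^sup>2)"
  proof (rule bigoI[where c = C])
    have "(u \<longlongrightarrow> 0) (at 0)" "(v \<longlongrightarrow> 0) (at 0)"
      using jet_tendsto[OF u] jet_tendsto[OF v] by simp_all
    then have "eventually (\<lambda>h. \<bar>u h\<bar> < \<delta> / 2) (at 0)" "eventually (\<lambda>h. \<bar>v h\<bar> < \<delta> / 2) (at 0)"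
      using \<open>\<delta> > 0\<close> by (auto simp: tendsto_iff dest!: spec[of _ "\<delta> / 2"])
    then show "eventually (\<lambda>h. norm (\<Psi> (u h) (v h) - (c2 + c3 * (u h + v h)))
        \<le> C * norm ((\<bar>u h\<bar> + \<bar>v h\<bar>)\<^sup>2)) (at 0)"
    proof eventually_elim
      case (elim h)
      then show ?case using \<Psi>[of "u h" "\<bar>u h\<bar> + \<bar>v h\<bar>" "v h"] by simp
    qed
  qed
  also have "(\<lambda>h. \<bar>u h\<bar> + \<bar>v h\<bar>) \<in> O[at 0](\<lambda>h. h)" using uO vO by (intro sum_in_bigo) auto
  then have "(\<lambda>h. (\<bar>u h\<bar> + \<bar>v h\<bar>)\<^sup>2) \<in> O[at 0](\<lambda>h. h\<^sup>2)" by (rule landau_o.big_power)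
  finally show ?thesis by (rule jet_bigo[OF main])
qed

text \<open>Since \<open>m > 0\<close>, the inner function tends to 0, so the local bound on
  \<open>R\<close> may be evaluated along it.\<close>

lemma bigo_norm_power_compose:
  fixes t :: "real \<Rightarrow> 'a::real_normed_vector" and R :: "'a \<Rightarrow> real"
  assumes R: "R \<in> O[nhds 0](\<lambda>t. norm t ^ k)" and t: "(\<lambda>h. norm (t h)) \<in> O[at 0](\<lambda>h. h ^ m)"
    and "m > 0"
  shows "(\<lambda>h. R (t h)) \<in> O[at 0](\<lambda>h. h ^ (m * k))"
proof -
  have "((\<lambda>h::real. h ^ m) \<longlongrightarrow> 0 ^ m) (at 0)" by (intro tendsto_intros)
  then have "((\<lambda>h::real. h ^ m) \<longlongrightarrow> 0) (at 0)" using \<open>m > 0\<close> by (simp add: zero_power)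
  with t have "((\<lambda>h. norm (t h)) \<longlongrightarrow> 0) (at 0)" by (rule bigo_tendsto_zero)
  then have "(t \<longlongrightarrow> 0) (at 0)" by (rule tendsto_norm_zero_cancel)
  with R have "(\<lambda>h. R (t h)) \<in> O[at 0](\<lambda>h. norm (t h) ^ k)"
    by (rule landau_o.big.compose)
  also have "(\<lambda>h. norm (t h) ^ k) \<in> O[at 0](\<lambda>h. (h ^ m) ^ k)"
    using t by (rule landau_o.big_power)
  finally show ?thesis by (simp add: power_mult)
qed

lemma bigo_norm_Pair:
  assumes "(\<lambda>h. norm (u h)) \<in> O[F](g)" "(\<lambda>h. norm (v h)) \<in> O[F](g)"
  shows "(\<lambda>h. norm (u h, v h)) \<in> O[F](g)"
proof (rule landau_o.big_trans)
  show "(\<lambda>h. norm (u h, v h)) \<in> O[F](\<lambda>h. norm (u h) + norm (v h))"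
    by (intro bigoI[where c = 1] always_eventually) (simp add: norm_Pair_le)
  show "(\<lambda>h. norm (u h) + norm (v h)) \<in> O[F](g)"
    using assms by (rule sum_in_bigo)
qed

section \<open>Exact error formulas for one step\<close>

text \<open>Expanding the nested \<open>let\<close> of a step by substitution would duplicate its
  terms; the existential form keeps a name and an equation for each intermediate value.\<close>

lemma Let_iff_ex: "Let a P \<longleftrightarrow> (\<exists>w. w = a \<and> P w)"
  by simp

text \<open>Only the exact factorization is assumed here, so this part is pure algebra without
  limits.\<close>

locale simple_root_scheme =
  fixes f :: "real \<Rightarrow> real" and \<alpha> \<kappa> g1 g2 :: real
    and G0 G1 :: "real \<Rightarrow> real" and G2 :: "real \<times> real \<Rightarrow> real"
    and H :: "real \<times> real \<times> real \<Rightarrow> real"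
    and \<Phi> :: "real \<Rightarrow> real" and \<Psi> :: "real \<Rightarrow> real \<Rightarrow> real"
  assumes f_eq: "f (\<alpha> + u) = u * \<Phi> u"
    and \<Phi>_diff: "\<Phi> u - \<Phi> v = (u - v) * \<Psi> u v"
begin

text \<open>All quantities are functions of the error \<open>h\<close> of the current iterate: \<open>W\<close>, \<open>Y\<close>, \<open>Z\<close> are
  the errors of \<open>w\<close>, \<open>y\<close>, \<open>z\<close>, and \<open>Fxw\<close>, \<open>Fyw\<close>, \<open>Fxy\<close> are divided differences. Factors of
  numerators and denominators that tend to \<open>0\<close> are cancelled: \<open>b = Y / W\<close>, \<open>B = Y / h\<close>,
  \<open>s = Z / Y\<close>, \<open>q = (z - y) / (z - x)\<close>, and \<open>r\<close> is the error of the next iterate divided by \<open>Z\<close>.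
  This keeps the expansions valid when \<open>\<kappa> f'(\<alpha>) = 1\<close>, where \<open>W\<close> is of higher order than \<open>h\<close>.\<close>

definition "W h = h * (1 - \<kappa> * \<Phi> h)"
definition "Fxw h = \<Phi> h + W h * \<Psi> h (W h)"
definition "A h = \<Psi> h (W h) / Fxw h"
definition "b h = h * A h"
definition "B h = W h * A h"
definition "Y h = W h * b h"
definition "t1 h = B h * (\<Phi> (Y h) / \<Phi> h)"
definition "t2 h = b h * (\<Phi> (Y h) / \<Phi> (W h))"
definition "Fyw h = \<Phi> (Y h) + W h * \<Psi> (Y h) (W h)"
definition "Fxy h = \<Phi> (Y h) + h * \<Psi> h (Y h)"
definition "s h = (1 - g1 - g2) * ((Fyw h - G0 (t1 h) * \<Phi> (Y h)) / Fyw h)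
  + g1 * ((Fxy h - G1 (t2 h) * \<Phi> (Y h)) / Fxy h)
  + g2 * ((Fxw h - G2 (t1 h, t2 h) * \<Phi> (Y h)) / Fxw h)"
definition "Z h = Y h * s h"
definition "t3 h = B h * s h * (\<Phi> (Z h) / \<Phi> h)"
definition "t4 h = b h * s h * (\<Phi> (Z h) / \<Phi> (W h))"
definition "t5 h = s h * (\<Phi> (Z h) / \<Phi> (Y h))"
definition "q h = (B h * (s h - 1)) / (B h * s h - 1)"
definition "d h = \<Phi> (Z h) + Y h * \<Psi> (Z h) (Y h)
  + ((\<Phi> (Z h) + h * \<Psi> (Z h) h) - (\<Phi> (W h) + h * \<Psi> (W h) h)) * q h"
definition "r h = (d h - H (t3 h, t4 h, t5 h) * \<Phi> (Z h)) / d h"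

text \<open>The numerator differs from \<open>(u - v) \<Phi>(u)\<close> by
  \<open>v (\<Phi>(u) - \<Phi>(v))\<close>, and similarly with \<open>\<Phi>(v)\<close>. Both forms
  keep the argument order of \<open>\<Psi>\<close>; the second lets \<open>Fxy\<close> be based on
  \<open>\<Phi>(Y)\<close>.\<close>

lemma divdiff_eq:
  assumes "u \<noteq> v"
  shows "divdiff f (\<alpha> + u) (\<alpha> + v) = \<Phi> u + v * \<Psi> u v"
    and "divdiff f (\<alpha> + u) (\<alpha> + v) = \<Phi> v + u * \<Psi> u v"
proof -
  have "u * \<Phi> u - v * \<Phi> v = (u - v) * \<Phi> u + v * (\<Phi> u - \<Phi> v)"
    and "u * \<Phi> u - v * \<Phi> v = (u - v) * \<Phi> v + u * (\<Phi> u - \<Phi> v)"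
    by (simp_all add: algebra_simps)
  then have "u * \<Phi> u - v * \<Phi> v = (u - v) * (\<Phi> u + v * \<Psi> u v)"
    and "u * \<Phi> u - v * \<Phi> v = (u - v) * (\<Phi> v + u * \<Psi> u v)"
    unfolding \<Phi>_diff by (simp_all add: algebra_simps)
  then show "divdiff f (\<alpha> + u) (\<alpha> + v) = \<Phi> u + v * \<Psi> u v"
    and "divdiff f (\<alpha> + u) (\<alpha> + v) = \<Phi> v + u * \<Psi> u v"
    using assms by (simp_all add: divdiff_def f_eq)
qed

lemma scheme_step_error:
  assumes "scheme_step f \<kappa> g1 g2 G0 G1 G2 H (\<alpha> + h) x'"
  shows "x' = \<alpha> + Z h * r h"
proof -
  from assms obtain w y t1' t2' z t3' t4' t5' d' where
    w: "w = \<alpha> + h - \<kappa> * f (\<alpha> + h)" and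
    y: "y = \<alpha> + h - f (\<alpha> + h) / divdiff f (\<alpha> + h) w" and
    t1': "t1' = f y / f (\<alpha> + h)" and t2': "t2' = f y / f w" and
    z: "z = y - ((1 - g1 - g2) / divdiff f y w * G0 t1'
                   + g1 / divdiff f (\<alpha> + h) y * G1 t2'
                   + g2 / divdiff f (\<alpha> + h) w * G2 (t1', t2')) * f y" and
    t3': "t3' = f z / f (\<alpha> + h)" and t4': "t4' = f z / f w" and t5': "t5' = f z / f y" and
    d': "d' = divdiff f z y + (divdiff f z (\<alpha> + h) - divdiff f w (\<alpha> + h)) * ((z - y) / (z - (\<alpha> + h)))" and
    ne: "\<alpha> + h \<noteq> w" "y \<noteq> w" "\<alpha> + h \<noteq> y" "z \<noteq> y" "z \<noteq> \<alpha> + h"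
         "divdiff f (\<alpha> + h) w \<noteq> 0" "divdiff f y w \<noteq> 0" "divdiff f (\<alpha> + h) y \<noteq> 0"
         "f (\<alpha> + h) \<noteq> 0" "f w \<noteq> 0" "f y \<noteq> 0" "d' \<noteq> 0" and
    x': "x' = z - H (t3', t4', t5') * (f z / d')"
    unfolding scheme_step_def Let_iff_ex by (elim exE conjE) (rule that)
  have w_eq: "w = \<alpha> + W h" by (simp add: w f_eq W_def algebra_simps)
  have hW: "h \<noteq> W h" using ne(1) by (simp add: w_eq)
  have Fxw: "divdiff f (\<alpha> + h) w = Fxw h" unfolding w_eq Fxw_def by (rule divdiff_eq(1)[OF hW])
  have Fxw0: "Fxw h \<noteq> 0" using ne(6) Fxw by simp
  have h0: "h \<noteq> 0" "\<Phi> h \<noteq> 0" using ne(9) by (auto simp: f_eq)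
  have W0: "W h \<noteq> 0" "\<Phi> (W h) \<noteq> 0" using ne(10) by (auto simp: f_eq w_eq)
  have YB: "Y h = h * B h" by (simp add: Y_def b_def B_def)
  \<comment> \<open>As \<open>Fxw = \<Phi>(h) + W \<Psi>(h, W)\<close>, the part of \<open>h\<close>
    that the step does not remove is \<open>h W \<Psi>(h, W) / Fxw\<close>.\<close>
  have "h * \<Phi> h / Fxw h = h - Y h"
    using Fxw0 by (simp add: YB B_def A_def Fxw_def field_simps)
  then have y_eq: "y = \<alpha> + Y h" by (simp add: y f_eq Fxw)
  have Y0: "Y h \<noteq> 0" "\<Phi> (Y h) \<noteq> 0" using ne(11) by (auto simp: f_eq y_eq)
  have t1_eq: "t1' = t1 h" using h0 by (simp add: t1' y_eq f_eq t1_def) (simp add: YB)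
  have t2_eq: "t2' = t2 h" using W0 by (simp add: t2' y_eq w_eq f_eq t2_def) (simp add: Y_def)
  have Fyw: "divdiff f y w = Fyw h" using ne(2) unfolding w_eq y_eq Fyw_def by (simp add: divdiff_eq(1))
  have Fxy: "divdiff f (\<alpha> + h) y = Fxy h" using ne(3) unfolding y_eq Fxy_def by (simp add: divdiff_eq(2))
  have "Fyw h \<noteq> 0" "Fxy h \<noteq> 0" using ne(7,8) Fyw Fxy by simp_all
  \<comment> \<open>The weights \<open>1 - g1 - g2\<close>, \<open>g1\<close>, \<open>g2\<close> sum
    to 1, so the three defects combine with a single leading 1.\<close>
  with Fxw0 have s_eq: "s h = 1 - ((1 - g1 - g2) / Fyw h * G0 (t1 h) + g1 / Fxy h * G1 (t2 h)
      + g2 / Fxw h * G2 (t1 h, t2 h)) * \<Phi> (Y h)"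
    unfolding s_def by (simp add: field_simps)
  have z_eq: "z = \<alpha> + Z h" 
    unfolding z y_eq f_eq t1_eq t2_eq Fyw[unfolded y_eq] Fxy[unfolded y_eq] Fxw Z_def s_eq
    by (simp add: algebra_simps)
  have t3_eq: "t3' = t3 h"
    using h0 by (simp add: t3' z_eq f_eq t3_def) (simp add: Z_def YB)
  have t4_eq: "t4' = t4 h"
    using W0 by (simp add: t4' z_eq w_eq f_eq t4_def) (simp add: Z_def Y_def)
  have t5_eq: "t5' = t5 h"
    using Y0 by (simp add: t5' z_eq y_eq f_eq t5_def) (simp add: Z_def)
  have q_eq: "(z - y) / (z - (\<alpha> + h)) = q h"
  proof -
    have "z - y = h * (B h * (s h - 1))" "z - (\<alpha> + h) = h * (B h * s h - 1)"
      by (simp_all add: z_eq y_eq Z_def YB algebra_simps)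
    then show ?thesis using h0 by (simp add: q_def)
  qed
  have "Z h \<noteq> Y h" "Z h \<noteq> h" "W h \<noteq> h" using ne(1,4,5) by (auto simp: z_eq y_eq w_eq)
  then have d_eq: "d' = d h" unfolding d' q_eq unfolding z_eq y_eq w_eq d_def
    by (simp add: divdiff_eq(1))
  have "d h \<noteq> 0" using ne(12) d_eq by simp
  then show ?thesis unfolding x' z_eq f_eq t3_eq t4_eq t5_eq d_eq r_def
    by (simp add: field_simps)
qed

end

section \<open>Expansions of the weight functions and of all quantities of a step\<close>

text \<open>The coefficient \<open>a\<close> acts from degree 2 on, outside what a jet records, and
  the cubic remainder becomes \<open>O(h ^ 3)\<close>.\<close>

lemma jet_compose_quadratic:
  assumes "(\<lambda>t. G t - (1 + t + a * t ^ 2)) \<in> O[nhds 0](\<lambda>t::real. t ^ 3)"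
    and t: "jet 3 t 0 b"
  shows "jet 3 (\<lambda>h. G (t h)) 1 b"
proof (rule jet_bigo)
  show "jet 3 (\<lambda>h. 1 + t h + a * (t h * t h)) 1 b"
    using jet_add[OF jet_add[OF jet_const[of 3 1] t] jet_mult[OF jet_const[of 3 a] jet_mult[OF t t]]] by simp
  have "(\<lambda>t. G t - (1 + t + a * t ^ 2)) \<in> O[nhds 0](\<lambda>t. norm t ^ 3)"
    using assms(1) by (simp flip: power_abs)
  from bigo_norm_power_compose[OF this, of t 1] jet_bigo_id[OF t]
  show "(\<lambda>h. G (t h) - (1 + t h + a * (t h * t h))) \<in> O[at 0](\<lambda>h. h ^ 3)"
    by (simp add: power2_eq_square)
qed

lemma jet_compose_quadratic2:
  assumes G: "(\<lambda>(t1, t2). G (t1, t2) - (1 + t1 + t2 + a * t1 ^ 2 + b * t2 ^ 2 + c * t1 * t2))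
      \<in> O[nhds (0, 0)](\<lambda>t::real \<times> real. norm t ^ 3)"
    and t1: "jet 3 t1 0 b1" and t2: "jet 3 t2 0 b2"
  shows "jet 3 (\<lambda>h. G (t1 h, t2 h)) 1 (b1 + b2)"
proof (rule jet_bigo)
  show "jet 3 (\<lambda>h. 1 + t1 h + t2 h + a * (t1 h * t1 h) + b * (t2 h * t2 h) + c * (t1 h * t2 h)) 1 (b1 + b2)"
    using jet_add[OF jet_add[OF jet_add[OF jet_add[OF jet_add[OF jet_const[of 3 1] t1] t2]
      jet_mult[OF jet_const[of 3 a] jet_mult[OF t1 t1]]] jet_mult[OF jet_const[of 3 b] jet_mult[OF t2 t2]]]
      jet_mult[OF jet_const[of 3 c] jet_mult[OF t1 t2]]] by simp
  have "(\<lambda>h. norm (t1 h, t2 h)) \<in> O[at 0](\<lambda>h. h ^ 1)"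
    using jet_bigo_id[OF t1] jet_bigo_id[OF t2] by (intro bigo_norm_Pair) simp_all
  from bigo_norm_power_compose[OF G[folded zero_prod_def] this]
  show "(\<lambda>h. G (t1 h, t2 h) - (1 + t1 h + t2 h + a * (t1 h * t1 h) + b * (t2 h * t2 h) + c * (t1 h * t2 h)))
      \<in> O[at 0](\<lambda>h. h ^ 3)"
    by (simp add: power2_eq_square mult.assoc)
qed

text \<open>The arguments are \<open>O(h ^ 2)\<close>: the linear terms do not reach degrees 0 and
  1, and the quadratic remainder is even \<open>O(h ^ 4)\<close>.\<close>

lemma jet_compose_linear3:
  assumes H: "(\<lambda>(t3, t4, t5). H (t3, t4, t5) - (1 + a * t3 + b * t4 + c * t5))
      \<in> O[nhds (0, 0, 0)](\<lambda>t::real \<times> real \<times> real. norm t ^ 2)"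
    and t: "jet 3 t3 0 0" "jet 3 t4 0 0" "jet 3 t5 0 0"
  shows "jet 3 (\<lambda>h. H (t3 h, t4 h, t5 h)) 1 0"
proof (rule jet_bigo)
  show "jet 3 (\<lambda>h. 1 + a * t3 h + b * t4 h + c * t5 h) 1 0"
    using jet_add[OF jet_add[OF jet_add[OF jet_const[of 3 1] jet_mult[OF jet_const[of 3 a] t(1)]]
      jet_mult[OF jet_const[of 3 b] t(2)]] jet_mult[OF jet_const[of 3 c] t(3)]] by simp
  have "(\<lambda>h. norm (t3 h, t4 h, t5 h)) \<in> O[at 0](\<lambda>h. h ^ 2)"
    using t[THEN jet_bigo_square] by (intro bigo_norm_Pair) simp_all
  from bigo_norm_power_compose[OF H[folded zero_prod_def] this]
  have "(\<lambda>h. H (t3 h, t4 h, t5 h) - (1 + a * t3 h + b * t4 h + c * t5 h)) \<in> O[at 0](\<lambda>h. h ^ 4)"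
    by simp
  then show "(\<lambda>h. H (t3 h, t4 h, t5 h) - (1 + a * t3 h + b * t4 h + c * t5 h)) \<in> O[at 0](\<lambda>h. h ^ 3)"
    by (rule landau_o.big_trans) (simp add: power_bigo_power)
qed

locale simple_root_scheme_expansion = simple_root_scheme +
  fixes c2 c3 C \<delta> a1 a2 a3 a4 a5 a6 a7 a8 :: real
  assumes \<delta>: "\<delta> > 0"
    and \<Psi>: "\<And>u v \<rho>. \<bar>u\<bar> \<le> \<rho> \<Longrightarrow> \<bar>v\<bar> \<le> \<rho> \<Longrightarrow> \<rho> < \<delta> \<Longrightarrow> \<bar>\<Psi> u v - (c2 + c3 * (u + v))\<bar> \<le> C * \<rho>\<^sup>2"
    and simple_root: "\<Phi> 0 \<noteq> 0"
    and G0: "(\<lambda>t. G0 t - (1 + t + a1 * t ^ 2)) \<in> O[nhds 0](\<lambda>t. t ^ 3)"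
    and G1: "(\<lambda>t. G1 t - (1 + t + a2 * t ^ 2)) \<in> O[nhds 0](\<lambda>t. t ^ 3)"
    and G2: "(\<lambda>(t1, t2). G2 (t1, t2)
            - (1 + t1 + t2 + a3 * t1 ^ 2 + a4 * t2 ^ 2 + a5 * t1 * t2))
         \<in> O[nhds (0, 0)](\<lambda>t. norm t ^ 3)"
    and H: "(\<lambda>(t3, t4, t5). H (t3, t4, t5) - (1 + a6 * t3 + a7 * t4 + a8 * t5))
         \<in> O[nhds (0, 0, 0)](\<lambda>t. norm t ^ 2)"
begin

abbreviation "c1 \<equiv> \<Phi> 0"
text \<open>First-order ratio of the errors of \<open>w\<close> and \<open>x\<close>; it may be
  zero.\<close>

abbreviation "\<omega> \<equiv> 1 - \<kappa> * c1"

lemma jet_\<Psi>: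
  assumes "jet 3 u 0 a" "jet 3 v 0 \<beta>"
  shows "jet 2 (\<lambda>h. \<Psi> (u h) (v h)) c2 (c3 * (a + \<beta>))"
  by (rule jet_second_difference[OF \<delta> \<Psi> assms[THEN jet_mono]]) simp_all

text \<open>From \<open>\<Phi>(u) = c1 + u \<Psi>(u, 0)\<close>, where the factor \<open>u\<close>
  lifts the precision of \<open>\<Psi>\<close> from 2 to 3.\<close>

lemma jet_\<Phi>:
  assumes "jet 3 u 0 a"
  shows "jet 3 (\<lambda>h. \<Phi> (u h)) c1 (a * c2)"
proof -
  have "jet 3 (\<lambda>h. 0) 0 0" by (rule jet_const)
  from jet_\<Psi>[OF assms this] have "jet 3 (\<lambda>h. u h * \<Psi> (u h) 0) 0 (a * c2)"
    using assms jet_mult_Suc[of 2] by (simp add: eval_nat_numeral)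
  from jet_add[OF jet_const[of 3 c1] this] have "jet 3 (\<lambda>h. c1 + u h * \<Psi> (u h) 0) c1 (a * c2)" by simp
  moreover have "c1 + u h * \<Psi> (u h) 0 = \<Phi> (u h)" for h using \<Phi>_diff[of "u h" 0] by simp
  ultimately show ?thesis by simp
qed

lemma jet_mult_\<Psi>:
  assumes "jet 3 u 0 a" "jet 3 v 0 \<beta>" "jet 3 w 0 \<gamma>"
  shows "jet 3 (\<lambda>h. w h * \<Psi> (u h) (v h)) 0 (\<gamma> * c2)"
  using jet_mult_Suc[of 2 w \<gamma>, OF _ jet_\<Psi>[OF assms(1,2)]] assms(3) by (simp add: eval_nat_numeral)

lemma jet_W: "jet 3 W 0 \<omega>"
  using jet_mult[OF jet_id jet_diff[OF jet_const[of 3 1] jet_mult[OF jet_const[of 3 \<kappa>] jet_\<Phi>[OF jet_id]]]]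
  by (simp add: W_def[abs_def])

lemma jet_Fxw: "jet 3 Fxw c1 (c2 + \<omega> * c2)"
  using jet_add[OF jet_\<Phi>[OF jet_id] jet_mult_\<Psi>[OF jet_id jet_W jet_W]]
  by (simp add: Fxw_def[abs_def])

text \<open>The linear coefficient stays unnamed because multiplication by \<open>h\<close> or
  \<open>W\<close> moves it to degree 2.\<close>

lemma jet_A: "\<exists>\<beta>. jet 2 A (c2 / c1) \<beta>"
  using jet_divide[OF jet_\<Psi>[OF jet_id jet_W] jet_mono[OF jet_Fxw]] simple_root
  by (auto simp: A_def[abs_def])

lemma jet_b: "jet 3 b 0 (c2 / c1)"
proof -
  from jet_A obtain \<beta> where "jet 2 A (c2 / c1) \<beta>" ..
  from jet_mult_Suc[OF jet_id this] show ?thesis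
    by (simp add: b_def[abs_def] eval_nat_numeral)
qed

lemma jet_B: "jet 3 B 0 (\<omega> * (c2 / c1))"
proof -
  from jet_A obtain \<beta> where "jet 2 A (c2 / c1) \<beta>" ..
  from jet_mult_Suc[of 2 W \<omega>, OF _ this] jet_W show ?thesis
    by (simp add: B_def[abs_def] eval_nat_numeral)
qed

lemma jet_Y: "jet 3 Y 0 0"
  using jet_mult[OF jet_W jet_b] by (simp add: Y_def[abs_def])

lemma jet_t1: "jet 3 t1 0 (\<omega> * (c2 / c1))"
  using jet_mult[OF jet_B jet_divide[OF jet_\<Phi>[OF jet_Y] jet_\<Phi>[OF jet_id]]] simple_root
  by (simp add: t1_def[abs_def])

lemma jet_t2: "jet 3 t2 0 (c2 / c1)"
  using jet_mult[OF jet_b jet_divide[OF jet_\<Phi>[OF jet_Y] jet_\<Phi>[OF jet_W]]] simple_root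
  by (simp add: t2_def[abs_def])

lemma jet_Fyw: "jet 3 Fyw c1 (\<omega> * c2)"
  using jet_add[OF jet_\<Phi>[OF jet_Y] jet_mult_\<Psi>[OF jet_Y jet_W jet_W]]
  by (simp add: Fyw_def[abs_def])

lemma jet_Fxy: "jet 3 Fxy c1 c2"
  using jet_add[OF jet_\<Phi>[OF jet_Y] jet_mult_\<Psi>[OF jet_id jet_Y jet_id]]
  by (simp add: Fxy_def[abs_def])

text \<open>Since \<open>Y = O(h ^ 2)\<close>, \<open>\<Phi>(Y)\<close> is \<open>c1\<close> up to
  degree 1, and the slope \<open>a\<close> of \<open>F\<close> cancels against that of
  \<open>c1 G\<close>. The slopes of \<open>Fyw\<close>, \<open>Fxy\<close>, \<open>Fxw\<close> are
  \<open>c1\<close> times those of \<open>t1\<close>, \<open>t2\<close>, \<open>t1 + t2\<close>,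
  which explains the derivative conditions on \<open>G0\<close>, \<open>G1\<close>,
  \<open>G2\<close>.\<close>

lemma jet_relative_defect:
  assumes F: "jet 3 F c1 a" and G: "jet 3 G 1 (a / c1)"
  shows "jet 3 (\<lambda>h. (F h - G h * \<Phi> (Y h)) / F h) 0 0"
  using jet_divide[OF jet_diff[OF F jet_mult[OF G jet_\<Phi>[OF jet_Y]]] F] simple_root by simp

text \<open>The three defects vanish separately to first order, so \<open>g1\<close> and
  \<open>g2\<close> can be arbitrary.\<close>

lemma jet_s: "jet 3 s 0 0"
proof -
  have 0: "jet 3 (\<lambda>h. (Fyw h - G0 (t1 h) * \<Phi> (Y h)) / Fyw h) 0 0"
    using jet_compose_quadratic[OF G0 jet_t1] by (intro jet_relative_defect[OF jet_Fyw]) simp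
  have 1: "jet 3 (\<lambda>h. (Fxy h - G1 (t2 h) * \<Phi> (Y h)) / Fxy h) 0 0"
    using jet_compose_quadratic[OF G1 jet_t2] by (intro jet_relative_defect[OF jet_Fxy]) simp
  have 2: "jet 3 (\<lambda>h. (Fxw h - G2 (t1 h, t2 h) * \<Phi> (Y h)) / Fxw h) 0 0"
    using jet_compose_quadratic2[OF G2 jet_t1 jet_t2]
    by (intro jet_relative_defect[OF jet_Fxw]) (simp add: add_divide_distrib add.commute)
  show ?thesis unfolding s_def[abs_def]
    using jet_add[OF jet_add[OF jet_mult[OF jet_const[of 3 "1 - g1 - g2"] 0]
      jet_mult[OF jet_const[of 3 g1] 1]] jet_mult[OF jet_const[of 3 g2] 2]]
    unfolding mult_zero_right mult_zero_left add_0_right .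
qed

lemma jet_Z: "jet 3 Z 0 0"
  using jet_mult[OF jet_Y jet_s] by (simp add: Z_def[abs_def])

lemma jet_t3: "jet 3 t3 0 0"
  using jet_mult[OF jet_mult[OF jet_B jet_s] jet_divide[OF jet_\<Phi>[OF jet_Z] jet_\<Phi>[OF jet_id]]] simple_root
  by (simp add: t3_def[abs_def])

lemma jet_t4: "jet 3 t4 0 0"
  using jet_mult[OF jet_mult[OF jet_b jet_s] jet_divide[OF jet_\<Phi>[OF jet_Z] jet_\<Phi>[OF jet_W]]] simple_root
  by (simp add: t4_def[abs_def])

lemma jet_t5: "jet 3 t5 0 0"
  using jet_mult[OF jet_s jet_divide[OF jet_\<Phi>[OF jet_Z] jet_\<Phi>[OF jet_Y]]] simple_root
  by (simp add: t5_def[abs_def])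

text \<open>\<open>B\<close> and \<open>s\<close> vanish at 0, so the denominator tends to
  -1.\<close>

lemma jet_q: "\<exists>\<beta>. jet 3 q 0 \<beta>"
  using jet_divide[OF jet_mult[OF jet_B jet_diff[OF jet_s jet_const[of 3 1]]]
      jet_diff[OF jet_mult[OF jet_B jet_s] jet_const[of 3 1]]]
  by (auto simp: q_def[abs_def])

text \<open>The two divided differences in the correction share the limit \<open>c1\<close>, and
  \<open>q\<close> tends to 0, so their product is \<open>O(h ^ 2)\<close>. The rest is
  \<open>c1 + O(h ^ 2)\<close> because \<open>Y\<close> and \<open>Z\<close> are
  \<open>O(h ^ 2)\<close>.\<close>

lemma jet_d: "jet 3 d c1 0"
proof -
  from jet_q obtain \<beta> where q: "jet 3 q 0 \<beta>" ..
  show ?thesis unfolding d_def[abs_def]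
    using jet_add[OF jet_add[OF jet_\<Phi>[OF jet_Z] jet_mult_\<Psi>[OF jet_Z jet_Y jet_Y]]
      jet_mult[OF jet_diff[OF jet_add[OF jet_\<Phi>[OF jet_Z] jet_mult_\<Psi>[OF jet_Z jet_id jet_id]]
        jet_add[OF jet_\<Phi>[OF jet_W] jet_mult_\<Psi>[OF jet_W jet_id jet_id]]] q]] by simp
qed

text \<open>Both \<open>d\<close> and \<open>H \<Phi>(Z)\<close> are \<open>c1 + O(h ^ 2)\<close>,
  so their difference has no terms of degree 0 or 1.\<close>

lemma jet_r: "jet 3 r 0 0"
  using jet_divide[OF jet_diff[OF jet_d jet_mult[OF jet_compose_linear3[OF H jet_t3 jet_t4 jet_t5]
    jet_\<Phi>[OF jet_Z]]] jet_d] simple_root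
  by (simp add: r_def[abs_def])

lemma next_error_expansion: "\<exists>K. (\<lambda>h. Z h * r h - K * h ^ 6) \<in> O[at 0](\<lambda>h. h ^ 7)"
proof -
  \<comment> \<open>Each precision is written as the order of vanishing plus 1 to match
    \<open>expands_mult_dvd\<close> with \<open>n = 1\<close>; every product then keeps its leading
    term.\<close>
  from jet_mono[OF jet_W, of "1 + 1"] obtain pW where W: "expands (1 + 1) W pW" "monom 1 1 dvd pW"
    by (auto simp: monom_1_dvd_iff' elim: jetE)
  from jet_mono[OF jet_b, of "1 + 1"] obtain pb where b: "expands (1 + 1) b pb" "monom 1 1 dvd pb"
    by (auto simp: monom_1_dvd_iff' elim: jetE)
  from jet_s obtain ps where s: "expands (2 + 1) s ps" "monom 1 2 dvd ps"
    by (rule jetE) (auto simp: monom_1_2_dvd_iff simp del: One_nat_def)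
  from jet_r obtain pr where r: "expands (2 + 1) r pr" "monom 1 2 dvd pr"
    by (rule jetE) (auto simp: monom_1_2_dvd_iff simp del: One_nat_def)
  have Y: "expands (2 + 1) (\<lambda>h. W h * b h) (pW * pb)" "monom 1 2 dvd pW * pb"
    using expands_mult_dvd[OF W b] mult_dvd_mono[OF W(2) b(2)] by (simp_all add: mult_monom numeral_2_eq_2)
  have sr: "expands (4 + 1) (\<lambda>h. s h * r h) (ps * pr)" "monom 1 4 dvd ps * pr"
    using expands_mult_dvd[OF s r] mult_dvd_mono[OF s(2) r(2)] by (simp_all add: mult_monom)
  have "expands (Suc 6) (\<lambda>h. W h * b h * (s h * r h)) (pW * pb * (ps * pr))"
    "monom 1 6 dvd pW * pb * (ps * pr)"
    using expands_mult_dvd[OF Y sr] mult_dvd_mono[OF Y(2) sr(2)] by (simp_all add: mult_monom)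
  from expands_leading_term[OF this] show ?thesis
    by (auto simp: Z_def Y_def mult.assoc)
qed

lemma scheme_step_asymptotics:
  obtains K M \<epsilon> where "\<epsilon> > 0"
    "\<And>x x'. scheme_step f \<kappa> g1 g2 G0 G1 G2 H x x' \<Longrightarrow> \<bar>x - \<alpha>\<bar> < \<epsilon> \<Longrightarrow>
      \<bar>(x' - \<alpha>) - K * (x - \<alpha>) ^ 6\<bar> \<le> M * \<bar>x - \<alpha>\<bar> ^ 7"
proof -
  from next_error_expansion obtain K where "(\<lambda>h. Z h * r h - K * h ^ 6) \<in> O[at 0](\<lambda>h. h ^ 7)" ..
  then obtain M where "eventually (\<lambda>h. norm (Z h * r h - K * h ^ 6) \<le> M * norm (h ^ 7)) (at 0)"
    by (elim landau_o.bigE)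
  then obtain \<epsilon> where \<epsilon>: "\<epsilon> > 0"
    "\<And>h. h \<noteq> 0 \<Longrightarrow> \<bar>h\<bar> < \<epsilon> \<Longrightarrow> \<bar>Z h * r h - K * h ^ 6\<bar> \<le> M * \<bar>h\<bar> ^ 7"
    unfolding eventually_at by (auto simp: power_abs abs_mult)
  show thesis
  proof (rule that[OF \<epsilon>(1)])
    fix x x' assume step: "scheme_step f \<kappa> g1 g2 G0 G1 G2 H x x'" and "\<bar>x - \<alpha>\<bar> < \<epsilon>"
    \<comment> \<open>A step never starts at the root, so an estimate in a punctured neighbourhood
      is enough.\<close>
    have "f x \<noteq> 0" using step by (simp add: scheme_step_def Let_def)
    then have "x - \<alpha> \<noteq> 0" using f_eq[of 0] by auto
    moreover have "x' - \<alpha> = Z (x - \<alpha>) * r (x - \<alpha>)"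
      using scheme_step_error[of "x - \<alpha>" x'] step by simp
    ultimately show "\<bar>(x' - \<alpha>) - K * (x - \<alpha>) ^ 6\<bar> \<le> M * \<bar>x - \<alpha>\<bar> ^ 7"
      using \<epsilon>(2) \<open>\<bar>x - \<alpha>\<bar> < \<epsilon>\<close> by simp
  qed
qed

end

section \<open>From a one-step estimate to local convergence\<close>

text \<open>As \<open>p > 1\<close>, the error at least halves in each step near \<alpha>, so a run
  cannot leave the region where the estimate holds.\<close>

lemma local_convergence_order_at_leastI:
  assumes "p > 1" "\<delta> > 0"
    and step: "\<And>x x'. S x x' \<Longrightarrow> \<bar>x - \<alpha>\<bar> < \<delta> \<Longrightarrow>
      \<bar>(x' - \<alpha>) - K * (x - \<alpha>) ^ p\<bar> \<le> C * \<bar>x - \<alpha>\<bar> ^ (p + 1)"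
  shows "local_convergence_order_at_least p S \<alpha>"
proof -
  \<comment> \<open>The sign of \<open>C\<close> is unknown, hence the absolute value. Below,
    \<open>\<epsilon> \<le> 1\<close> reduces the powers \<open>p\<close> and \<open>p + 1\<close>
    to 2, and the last bound gives \<open>M * \<epsilon> \<le> 1 / 2\<close>, with
    \<open>M + 1\<close> keeping the denominator positive.\<close>
  define M where "M = \<bar>K\<bar> + \<bar>C\<bar>"
  define \<epsilon> where "\<epsilon> = min \<delta> (min 1 (1 / (2 * (M + 1))))"
  have M: "M \<ge> 0" by (simp add: M_def)
  then have \<epsilon>: "\<epsilon> > 0" "\<epsilon> \<le> \<delta>" "\<epsilon> \<le> 1" "M * \<epsilon> \<le> 1 / 2"
  proof -
    show "\<epsilon> > 0" using M \<open>\<delta> > 0\<close> by (simp add: \<epsilon>_def)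
    show "\<epsilon> \<le> \<delta>" "\<epsilon> \<le> 1" unfolding \<epsilon>_def by linarith+
    have "M * \<epsilon> \<le> M * (1 / (2 * (M + 1)))" using M by (intro mult_left_mono) (auto simp: \<epsilon>_def)
    also have "\<dots> \<le> 1 / 2" using M by (simp add: field_simps)
    finally show "M * \<epsilon> \<le> 1 / 2" .
  qed
  have half: "\<bar>x' - \<alpha>\<bar> \<le> \<bar>x - \<alpha>\<bar> / 2" if "S x x'" "\<bar>x - \<alpha>\<bar> < \<epsilon>" for x x'
  proof -
    define e where "e = \<bar>x - \<alpha>\<bar>"
    have e: "0 \<le> e" "e \<le> \<epsilon>" "e \<le> 1" using that(2) \<epsilon> by (auto simp: e_def)
    have "\<bar>x' - \<alpha>\<bar> \<le> \<bar>K * (x - \<alpha>) ^ p\<bar> + C * e ^ (p + 1)"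
      using step[OF that(1)] that(2) \<epsilon>(2) by (simp add: e_def)
    also have "\<dots> \<le> \<bar>K\<bar> * e ^ p + \<bar>C\<bar> * e ^ (p + 1)"
      using e by (intro add_mono mult_right_mono) (auto simp: e_def abs_mult power_abs)
    also have "\<dots> \<le> \<bar>K\<bar> * e ^ 2 + \<bar>C\<bar> * e ^ 2"
      using e \<open>p > 1\<close> by (intro add_mono mult_left_mono power_decreasing) auto
    also have "\<dots> = (M * e) * e" by (simp add: M_def power2_eq_square algebra_simps)
    also have "\<dots> \<le> (M * \<epsilon>) * e" using e M by (intro mult_right_mono mult_left_mono) auto
    also have "\<dots> \<le> 1 / 2 * e" using e \<epsilon> by (intro mult_right_mono) auto
    finally show ?thesis by (simp add: e_def)
  qed
  \<comment> \<open>Only the first \<open>n\<close> steps are assumed, which covers runs that break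
    down later.\<close>
  have bound: "\<bar>x n - \<alpha>\<bar> \<le> \<bar>x 0 - \<alpha>\<bar> / 2 ^ n"
    if "\<bar>x 0 - \<alpha>\<bar> < \<epsilon>" "\<forall>m<n. S (x m) (x (Suc m))" for x :: "nat \<Rightarrow> real" and n
    using that(2)
  proof (induction n)
    case (Suc n)
    then have IH: "\<bar>x n - \<alpha>\<bar> \<le> \<bar>x 0 - \<alpha>\<bar> / 2 ^ n" by simp
    also have "\<dots> \<le> \<bar>x 0 - \<alpha>\<bar> / 1" by (intro divide_left_mono) auto
    finally have "\<bar>x n - \<alpha>\<bar> < \<epsilon>" using that(1) by simp
    with half[of "x n" "x (Suc n)"] Suc.prems have "\<bar>x (Suc n) - \<alpha>\<bar> \<le> \<bar>x n - \<alpha>\<bar> / 2" by simp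
    also have "\<dots> \<le> \<bar>x 0 - \<alpha>\<bar> / 2 ^ n / 2" using IH by (intro divide_right_mono) auto
    finally show ?case by simp
  qed simp
  show ?thesis
    unfolding local_convergence_order_at_least_def
  proof (rule exI[of _ K], rule exI[of _ C], rule exI[of _ \<epsilon>], intro conjI allI impI \<epsilon>(1))
    fix x :: "nat \<Rightarrow> real" and n assume x0: "\<bar>x 0 - \<alpha>\<bar> < \<epsilon>" and S: "\<forall>m\<le>n. S (x m) (x (Suc m))"
    have "\<bar>x n - \<alpha>\<bar> \<le> \<bar>x 0 - \<alpha>\<bar> / 2 ^ n" using S by (intro bound x0) auto
    also have "\<dots> \<le> \<bar>x 0 - \<alpha>\<bar> / 1" by (intro divide_left_mono) auto
    finally have "\<bar>x n - \<alpha>\<bar> < \<delta>" using x0 \<epsilon>(2) by simp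
    then show "\<bar>(x (Suc n) - \<alpha>) - K * (x n - \<alpha>) ^ p\<bar> \<le> C * \<bar>x n - \<alpha>\<bar> ^ (p + 1)"
      using S by (intro step) auto
  next
    fix x :: "nat \<Rightarrow> real" assume x0: "\<bar>x 0 - \<alpha>\<bar> < \<epsilon>" and S: "\<forall>n. S (x n) (x (Suc n))"
    have lim: "(\<lambda>n. \<bar>x 0 - \<alpha>\<bar> * (1 / 2) ^ n) \<longlonglongrightarrow> \<bar>x 0 - \<alpha>\<bar> * 0"
      by (intro tendsto_intros LIMSEQ_power_zero) auto
    have "\<forall>n. norm (x n - \<alpha>) \<le> \<bar>x 0 - \<alpha>\<bar> * (1 / 2) ^ n"
      using bound[of x, OF x0] S by (simp add: power_divide)
    from Lim_null_comparison[OF always_eventually[OF this] lim[unfolded mult_zero_right]]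
    have "(\<lambda>n. x n - \<alpha>) \<longlonglongrightarrow> 0" .
    then show "x \<longlonglongrightarrow> \<alpha>" by (simp add: LIM_zero_iff)
  qed
qed

text \<open>The definition demands continuity only at the last stage; when the chain is cut earlier,
  continuity there comes from differentiability.\<close>

lemma Ck_on_mono:
  assumes "Ck_on n S f" "m \<le> n"
  shows "Ck_on m S f"
  using assms
proof (induction n arbitrary: m f)
  case (Suc n)
  show ?case
  proof (cases m)
    case 0
    have "f differentiable_on S"
      using Suc.prems(1) by (simp add: differentiable_on_def differentiable_at_withinI)
    then show ?thesis using 0 by (simp add: differentiable_imp_continuous_on)
  next
    case (Suc k)
    then show ?thesis using Suc.prems Suc.IH by simp
  qed
qed simp

theorem theorem6:
  fixes D :: "real set" and f :: "real \<Rightarrow> real" and \<alpha> \<kappa> g1 g2 :: real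
    and a1 a2 a3 a4 a5 a6 a7 a8 :: real
    and G0 G1 :: "real \<Rightarrow> real"
    and G2 :: "real \<times> real \<Rightarrow> real"
    and H :: "real \<times> real \<times> real \<Rightarrow> real"
  assumes "open D" and "is_interval D"
    and "Ck_on 7 D f"
    and "\<alpha> \<in> D" and "f \<alpha> = 0" and "deriv f \<alpha> \<noteq> 0"
    and "\<kappa> \<noteq> 0"
    and "smooth_near 0 G0" and "smooth_near 0 G1"
    and "smooth_near (0, 0) G2" and "smooth_near (0, 0, 0) H"
    and "(\<lambda>t. G0 t - (1 + t + a1 * t ^ 2)) \<in> O[nhds 0](\<lambda>t. t ^ 3)"
    and "(\<lambda>t. G1 t - (1 + t + a2 * t ^ 2)) \<in> O[nhds 0](\<lambda>t. t ^ 3)"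
    and "(\<lambda>(t1, t2). G2 (t1, t2)
            - (1 + t1 + t2 + a3 * t1 ^ 2 + a4 * t2 ^ 2 + a5 * t1 * t2))
         \<in> O[nhds (0, 0)](\<lambda>t. norm t ^ 3)"
    and "(\<lambda>(t3, t4, t5). H (t3, t4, t5) - (1 + a6 * t3 + a7 * t4 + a8 * t5))
         \<in> O[nhds (0, 0, 0)](\<lambda>t. norm t ^ 2)"
    and "G0 0 = 1" and "G1 0 = 1" and "G2 (0, 0) = 1" and "H (0, 0, 0) = 1"
    and "(G0 has_real_derivative 1) (at 0)"
    and "(G1 has_real_derivative 1) (at 0)"
    and "((\<lambda>t1. G2 (t1, 0)) has_real_derivative 1) (at 0)"
    and "((\<lambda>t2. G2 (0, t2)) has_real_derivative 1) (at 0)"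
  shows "local_convergence_order_at_least 6 (scheme_step f \<kappa> g1 g2 G0 G1 G2 H) \<alpha>"
proof -
  from Ck_on_mono[OF assms(3), of 4] have "Ck_on 4 D f" by simp
  then obtain \<Phi> \<Psi> :: "real \<Rightarrow> _" and c2 c3 C \<delta> :: real where "\<delta> > 0"
    "\<And>u. f (\<alpha> + u) = u * \<Phi> u" "\<Phi> 0 = deriv f \<alpha>"
    "\<And>u v. \<Phi> u - \<Phi> v = (u - v) * \<Psi> u v"
    "\<And>u v \<rho>. \<bar>u\<bar> \<le> \<rho> \<Longrightarrow> \<bar>v\<bar> \<le> \<rho> \<Longrightarrow> \<rho> < \<delta> \<Longrightarrow> \<bar>\<Psi> u v - (c2 + c3 * (u + v))\<bar> \<le> C * \<rho>\<^sup>2"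
    by (rule simple_root_factorization[where f = f, OF assms(1,4) _ assms(5)]) (rule that)
  then interpret simple_root_scheme_expansion f \<alpha> \<kappa> g1 g2 G0 G1 G2 H \<Phi> \<Psi> c2 c3 C \<delta> a1 a2 a3 a4 a5 a6 a7 a8
    using assms(6,12-15) by unfold_locales auto
  show ?thesis
    by (rule scheme_step_asymptotics, rule local_convergence_order_at_leastI) auto
qed

end
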